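(* Let $F(x,y,z)=\sum_{n,i,j\ge0}a_{n,i,j}\frac{x^{n}}{n!}y^{i}z^{j}$, where $a_{n,i,j}$ is the number of $n$-edge increasing ordered trees with exactly $i$ Klazar violators and exactly $j$ leaves that do not terminate a sibling descent. Then \[F(x,y,z)=\left(\frac{1+y-2z}{1+y-2z\,e^{x(1+y-2z)}}\right)^{1/2}.\]
   Context: An $n$-edge increasing ordered tree is a rooted ordered (plane) tree with vertices labeled bijectively by $0,1,\dots,n$ so that each child's label exceeds its parent's; vertices are identified with labels. A sibling descent is a pair of adjacent siblings $u,v$, with $v$ immediately to the right of $u$, such that $u>v$; $v$ terminates the descent and is called a descent terminator. The big cohort of $v$ is the maximal terminal (rightmost) sublist of the left-to-right list of siblings strictly to the left of $v$ all of whose entries exceed $v$; the associate of a descent terminator $v$ is the smallest entry of its big cohort. A Klazar violator is a descent terminator $v$ whose associate is smaller than every child of $v$ (vacuously true for a leaf). A leaf is a vertex with no children; the root of the one-vertex tree ($n=0$) is not counted as a leaf, so $a_{0,0,0}=1$ and the constant term in $x$ is $1$. The right-hand side is the formal power series in $x$ with constant term $1$ and coefficients in $\mathbb{Q}[y,z]$. *)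

theory Defs
  imports "HOL-Computational_Algebra.Computational_Algebra"
begin

section \<open>Increasing ordered trees\<close>

datatype otree = Node (label: nat) (children: "otree list")

fun labels :: "otree \<Rightarrow> nat list" where
  "labels (Node k ts) = k # concat (map labels ts)"

fun increasing :: "otree \<Rightarrow> bool" where
  "increasing (Node k ts) \<longleftrightarrow> (\<forall>t\<in>set ts. k < label t \<and> increasing t)"

fun subtrees :: "otree \<Rightarrow> otree set" where
  "subtrees (Node k ts) = insert (Node k ts) (\<Union>t\<in>set ts. subtrees t)"

text \<open>Having the labels \<open>0, \<dots>, n\<close>, each exactly once, means having \<open>n + 1\<close> vertices, that is,
  \<open>n\<close> edges.\<close>

definition increasing_trees :: "nat \<Rightarrow> otree set" where
  "increasing_trees n = {t. increasing t \<and> distinct (labels t) \<and> set (labels t) = {0..n}}"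


section \<open>Descent terminators, Klazar violators and leaves\<close>

text \<open>Vertices are identified with their labels. The predicate \<open>left_siblings t v ls\<close> says that
  \<open>v\<close> is a non-root vertex of \<open>t\<close> and that \<open>ls\<close> is the left-to-right list of the siblings strictly
  to the left of \<open>v\<close>; when the labels of \<open>t\<close> are distinct, \<open>ls\<close> is determined by \<open>t\<close> and \<open>v\<close>.\<close>

definition left_siblings :: "otree \<Rightarrow> nat \<Rightarrow> nat list \<Rightarrow> bool" where
  "left_siblings t v ls \<longleftrightarrow> (\<exists>s\<in>subtrees t. \<exists>rs. map label (children s) = ls @ v # rs)"

definition child_of :: "otree \<Rightarrow> nat \<Rightarrow> nat \<Rightarrow> bool" where
  "child_of t v c \<longleftrightarrow> (\<exists>s\<in>subtrees t. label s = v \<and> c \<in> label ` set (children s))"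

definition ends_descent :: "nat \<Rightarrow> nat list \<Rightarrow> bool" where
  "ends_descent v ls \<longleftrightarrow> ls \<noteq> [] \<and> last ls > v"

definition descent_terminator :: "otree \<Rightarrow> nat \<Rightarrow> bool" where
  "descent_terminator t v \<longleftrightarrow> (\<exists>ls. left_siblings t v ls \<and> ends_descent v ls)"

definition big_cohort :: "nat \<Rightarrow> nat list \<Rightarrow> nat list" where
  "big_cohort v ls = rev (takeWhile (\<lambda>u. u > v) (rev ls))"

text \<open>Meaningful only if \<open>ends_descent v ls\<close>, which makes the big cohort non-empty.\<close>

definition associate :: "nat \<Rightarrow> nat list \<Rightarrow> nat" where
  "associate v ls = Min (set (big_cohort v ls))"

definition klazar_violator :: "otree \<Rightarrow> nat \<Rightarrow> bool" where
  "klazar_violator t v \<longleftrightarrow>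
     (\<exists>ls. left_siblings t v ls \<and> ends_descent v ls \<and> (\<forall>c. child_of t v c \<longrightarrow> associate v ls < c))"

text \<open>The root of the one-vertex tree is not a leaf; every other root has a child anyway.\<close>

definition leaf :: "otree \<Rightarrow> nat \<Rightarrow> bool" where
  "leaf t v \<longleftrightarrow> v \<in> set (labels t) \<and> v \<noteq> label t \<and> (\<nexists>c. child_of t v c)"

definition tree_count :: "nat \<Rightarrow> nat \<Rightarrow> nat \<Rightarrow> nat" where
  "tree_count n i j = card {t \<in> increasing_trees n.
      card {v. klazar_violator t v} = i \<and> card {v. leaf t v \<and> \<not> descent_terminator t v} = j}"


section \<open>The generating function\<close>

text \<open>The polynomial ring \<open>\<rat>[y,z]\<close> is represented as \<open>\<rat>[y][z]\<close>.\<close>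

definition var_y :: "rat poly poly" where "var_y = [:[:0, 1:]:]"

definition var_z :: "rat poly poly" where "var_z = [:0, 1:]"

text \<open>For fixed \<open>n\<close> there are only finitely many non-zero terms, all of them with \<open>i \<le> n\<close> and
  \<open>j \<le> n\<close>; see \<open>tree_count_eq_0\<close> below.\<close>

definition tree_gf :: "rat poly poly fps" where
  "tree_gf = Abs_fps (\<lambda>n. \<Sum>i\<le>n. \<Sum>j\<le>n.
     smult [:of_nat (tree_count n i j) / fact n:] (var_y ^ i * var_z ^ j))"


section \<open>The right-hand side\<close>

text \<open>The quotient is formed over the field of fractions of \<open>\<rat>[y,z]\<close>, because the constant term
  \<open>1 + y - 2 z\<close> of the denominator is not invertible in \<open>\<rat>[y,z]\<close>.\<close>

type_synonym ratfun = "rat poly poly fract"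

definition embed_fps :: "rat poly poly fps \<Rightarrow> ratfun fps" where
  "embed_fps f = Abs_fps (\<lambda>n. to_fract (fps_nth f n))"

definition Y :: ratfun where "Y = to_fract var_y"

definition Z :: ratfun where "Z = to_fract var_z"

text \<open>The first argument of \<open>fps_radical\<close> selects the root of the constant term. Here \<open>1\<close> is chosen,
  so that this is the square root with constant term \<open>1\<close>, as \<open>fps_sqrt_rhs\<close> below confirms.\<close>

definition fps_sqrt :: "ratfun fps \<Rightarrow> ratfun fps" where
  "fps_sqrt f = fps_radical (\<lambda>_ _. 1) 2 f"


section \<open>Well-definedness\<close>

lemma label_in_labels: "label t \<in> set (labels t)"
  by (cases t) auto

lemma finite_bounded_trees:
  assumes "finite A"
  shows "finite {t. set (labels t) \<subseteq> A \<and> length (labels t) \<le> m}"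
proof (induction m)
  case 0
  have "{t. set (labels t) \<subseteq> A \<and> length (labels t) \<le> 0} = {}"
    using label_in_labels by fastforce
  then show ?case by (simp only: finite.emptyI)
next
  case (Suc m)
  let ?B = "{t. set (labels t) \<subseteq> A \<and> length (labels t) \<le> m}"
  let ?L = "{ts. set ts \<subseteq> ?B \<and> length ts \<le> m}"
  have "{t. set (labels t) \<subseteq> A \<and> length (labels t) \<le> Suc m} \<subseteq> (\<lambda>(k, ts). Node k ts) ` (A \<times> ?L)"
  proof
    fix t assume t: "t \<in> {t. set (labels t) \<subseteq> A \<and> length (labels t) \<le> Suc m}"
    obtain k ts where k: "t = Node k ts" by (cases t)
    have len: "length (concat (map labels ts)) \<le> m" using t k by simp
    have part: "length (labels s) \<le> length (concat (map labels ts))" if "s \<in> set ts" for s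
      using that by (induction ts) auto
    have "length ts \<le> length (concat (map labels ts))"
    proof (induction ts)
      case (Cons s ts)
      have "length (labels s) \<ge> 1" by (cases s) simp
      with Cons show ?case by simp
    qed simp
    with len part have "ts \<in> ?L" using t k by fastforce
    moreover have "k \<in> A" using t k by simp
    ultimately show "t \<in> (\<lambda>(k, ts). Node k ts) ` (A \<times> ?L)" using k by force
  qed
  moreover have "finite ((\<lambda>(k, ts). Node k ts) ` (A \<times> ?L))"
    using finite_lists_length_le[OF Suc.IH] assms by blast
  ultimately show ?case by (rule finite_subset)
qed

lemma finite_increasing_trees: "finite (increasing_trees n)"
proof (rule finite_subset)
  show "increasing_trees n \<subseteq> {t. set (labels t) \<subseteq> {0..n} \<and> length (labels t) \<le> Suc n}"
  proof
    fix t assume t: "t \<in> increasing_trees n"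
    have "length (labels t) = card {0..n}"
      using t distinct_card[of "labels t"] by (simp add: increasing_trees_def)
    then show "t \<in> {t. set (labels t) \<subseteq> {0..n} \<and> length (labels t) \<le> Suc n}"
      using t by (simp add: increasing_trees_def)
  qed
qed (rule finite_bounded_trees, simp)

lemma subtree_child:
  assumes "increasing t" "s \<in> subtrees t" "c \<in> set (children s)"
  shows "label t < label c \<and> label c \<in> set (labels t)"
  using assms
proof (induction t rule: subtrees.induct)
  case (1 k ts)
  show ?case
  proof (cases "s = Node k ts")
    case True
    then show ?thesis using 1 label_in_labels by auto
  next
    case False
    then obtain u where u: "u \<in> set ts" "s \<in> subtrees u" using 1 by auto
    have "label u < label c \<and> label c \<in> set (labels u)" using 1 u by auto
    moreover have "k < label u" using 1 u by auto
    ultimately show ?thesis using u(1) by auto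
  qed
qed

lemma left_siblings_nonroot:
  assumes "increasing t" "left_siblings t v ls"
  shows "v \<in> set (labels t) - {label t}"
proof -
  obtain s rs where s: "s \<in> subtrees t" "map label (children s) = ls @ v # rs"
    using assms(2) by (auto simp: left_siblings_def)
  then have "v \<in> label ` set (children s)"
    by (metis in_set_conv_decomp set_map)
  then obtain c where "c \<in> set (children s)" "v = label c" by blast
  with subtree_child[OF assms(1) s(1)] show ?thesis by fastforce
qed

lemma tree_count_eq_0:
  assumes "i > n \<or> j > n"
  shows "tree_count n i j = 0"
proof -
  have "card {v. klazar_violator t v} \<le> n \<and> card {v. leaf t v \<and> \<not> descent_terminator t v} \<le> n"
    if t: "t \<in> increasing_trees n" for t
  proof -
    let ?V = "set (labels t) - {label t}"
    have "card ?V = n" "finite ?V"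
      using t label_in_labels[of t] by (auto simp: increasing_trees_def)
    moreover have "{v. klazar_violator t v} \<subseteq> ?V"
      using t left_siblings_nonroot by (auto simp: klazar_violator_def increasing_trees_def)
    moreover have "{v. leaf t v \<and> \<not> descent_terminator t v} \<subseteq> ?V"
      by (auto simp: leaf_def)
    ultimately show ?thesis by (metis card_mono)
  qed
  then have "{t \<in> increasing_trees n. card {v. klazar_violator t v} = i \<and>
      card {v. leaf t v \<and> \<not> descent_terminator t v} = j} = {}"
    using assms by fastforce
  then show ?thesis unfolding tree_count_def by (simp only: card.empty)
qed

lemma rhs_nth_0:
  "(fps_const (1 + Y - 2 * Z) /
     (fps_const (1 + Y) - fps_const (2 * Z) * fps_exp (1 + Y - 2 * Z))) $ 0 = 1"
proof -
  have two: "to_fract 2 = (2 :: ratfun)"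
    using to_fract_add[of 1 "1 :: rat poly poly"] by simp
  have "1 + Y - 2 * Z = to_fract (1 + var_y - 2 * var_z)"
    by (simp add: Y_def Z_def two)
  moreover have "1 + var_y - 2 * var_z \<noteq> 0"
    by (simp add: var_y_def var_z_def numeral_poly one_pCons)
  ultimately have "1 + Y - 2 * Z \<noteq> 0" by (metis to_fract_eq_0_iff)
  then show ?thesis
    by (simp add: fps_divide_unit)
qed

lemma fps_sqrt_rhs:
  fixes R :: "ratfun fps"
  defines "R \<equiv> fps_const (1 + Y - 2 * Z) /
    (fps_const (1 + Y) - fps_const (2 * Z) * fps_exp (1 + Y - 2 * Z))"
  shows "fps_sqrt R ^ 2 = R" "fps_sqrt R $ 0 = 1"
  using power_radical[of R "\<lambda>_ _. 1" 1] rhs_nth_0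
  by (simp_all add: fps_sqrt_def R_def numeral_2_eq_2)

end

theory Submission
  imports Defs
begin

text \<open>The idea is to build increasing trees by adding the labels in increasing order. The largest
  label \<open>n + 1\<close> of a tree with \<open>n + 1\<close> edges is at a leaf, and it can be put at any of the \<open>2 n + 1\<close>
  places of a tree with \<open>n\<close> edges. A new label above all others never ends a descent, so the new
  leaf has weight \<open>z\<close>. If it becomes a child of a leaf that does not end a descent, the factor \<open>z\<close> of
  that leaf disappears; if it is placed directly to the left of such a leaf, the leaf becomes a
  Klazar violator, and its factor \<open>z\<close> turns into \<open>y\<close>. No other weight changes: a non-empty big
  cohort keeps its smallest entry, and a vertex with children whose big cohort was empty does not
  become a violator, because its associate is then \<open>n + 1\<close>. This is \<open>sum_forest_weight_grafts\<close>.

  With \<open>a = 1 + y - 2 z\<close>, and \<open>P\<^sub>n\<close> the sum of \<open>y\<^sup>i z\<^sup>j\<close> over all trees with \<open>n\<close> edges, it follows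
  that \<open>P\<close> at \<open>n + 1\<close> is \<open>a z\<close> times the \<open>z\<close>-derivative of \<open>P\<^sub>n\<close>, plus \<open>(2 n + 1) z P\<^sub>n\<close>
  (\<open>weight_sum_Suc\<close>). For the generating function this is the linear equation
  \<open>(1 - 2 x z) F\<^sub>x = a z F\<^sub>z + z F\<close>.

  Instead of solving the equation, one verifies the answer. The series
  \<open>D = 1 + y - 2 z exp (a x)\<close> is annihilated by the derivation
  \<open>(1 - 2 x z) \<partial>\<^sub>x - a z \<partial>\<^sub>z\<close>, while \<open>F\<close> is multiplied by \<open>z\<close>. By the product rule \<open>F\<^sup>2 D\<close> is
  multiplied by \<open>2 z\<close>, and the same is true of \<open>a\<close>. As both have constant term \<open>a\<close> in \<open>x\<close>,
  they agree (\<open>tree_gf_square\<close>). All of this takes place over \<open>\<rat>[y,z]\<close>; only the final division by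
  \<open>D\<close> and the choice of the square root need rational functions.\<close>


section \<open>Weights of vertices and forests\<close>


abbreviation forest_labels :: "otree list \<Rightarrow> nat list" where
  "forest_labels ts \<equiv> concat (map labels ts)"

text \<open>Both statistics are sums over the non-root vertices of quantities that depend only on the left
  siblings, the label, and the labels of the children. These triples are collected in preorder. The
  first argument holds the labels of the siblings that have already been passed, so that the
  recursion can run along a list of siblings; since \<open>vertex_contexts\<close> is a list, taking the middle
  components recovers the list of labels.\<close>

fun vertex_contexts :: "nat list \<Rightarrow> otree list \<Rightarrow> (nat list \<times> nat \<times> nat list) list" where
  "vertex_contexts ls [] = []"
| "vertex_contexts ls (Node v cs # ts) =
     (ls, v, map label cs) # vertex_contexts [] cs @ vertex_contexts (ls @ [v]) ts"

fun violator_context :: "nat list \<times> nat \<times> nat list \<Rightarrow> bool" where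
  "violator_context (ls, v, cs) \<longleftrightarrow> ends_descent v ls \<and> (\<forall>c\<in>set cs. associate v ls < c)"

fun leaf_context :: "nat list \<times> nat \<times> nat list \<Rightarrow> bool" where
  "leaf_context (ls, v, cs) \<longleftrightarrow> cs = [] \<and> \<not> ends_descent v ls"

text \<open>The two factors never combine to \<open>y z\<close>, because violators end a descent and the counted leaves
  do not. A leaf that ends a descent is a violator, so leaves have weight \<open>y\<close> or \<open>z\<close> and other
  vertices have weight \<open>1\<close> or \<open>y\<close>.\<close>

definition context_weight :: "nat list \<times> nat \<times> nat list \<Rightarrow> rat poly poly" where
  "context_weight c =
     (if violator_context c then var_y else 1) * (if leaf_context c then var_z else 1)"

definition forest_weight :: "nat list \<Rightarrow> otree list \<Rightarrow> rat poly poly" where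
  "forest_weight ls ts = prod_list (map context_weight (vertex_contexts ls ts))"

lemma forest_weight_simps [simp]:
  "forest_weight ls [] = 1"
  "forest_weight ls (Node v cs # ts) =
     context_weight (ls, v, map label cs) * forest_weight [] cs * forest_weight (ls @ [v]) ts"
  by (simp_all add: forest_weight_def mult.assoc)


section \<open>Grafting the largest label\<close>

text \<open>All ways to add \<open>m\<close> as a leaf, either among the roots of the forest or below one of its
  vertices. A list rather than a set, so that sums over it follow the recursion without any
  disjointness conditions.\<close>

fun grafts :: "nat \<Rightarrow> otree list \<Rightarrow> otree list list" where
  "grafts m [] = [[Node m []]]"
| "grafts m (Node v cs # ts) =
     (Node m [] # Node v cs # ts) #
     map (\<lambda>cs'. Node v cs' # ts) (grafts m cs) @ map ((#) (Node v cs)) (grafts m ts)"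

text \<open>The inverse of grafting. It would discard the children of \<open>m\<close>, and is meant for forests in which
  \<open>m\<close> labels a leaf, if anything.\<close>

fun prune :: "nat \<Rightarrow> otree list \<Rightarrow> otree list" where
  "prune m [] = []"
| "prune m (Node v cs # ts) =
     (if v = m then prune m ts else Node v (prune m cs) # prune m ts)"


lemma forest_labels_empty_iff: "forest_labels ts = [] \<longleftrightarrow> ts = []"
proof -
  have "labels t \<noteq> []" for t by (cases t) simp
  then show ?thesis by (cases ts) simp_all
qed

lemma grafts_labels:
  "ts' \<in> set (grafts m ts) \<Longrightarrow> mset (forest_labels ts') = add_mset m (mset (forest_labels ts))"
  by (induction m ts arbitrary: ts' rule: grafts.induct) auto

lemma grafts_top_labels:
  "ts' \<in> set (grafts m ts) \<Longrightarrow>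
     set (map label ts') = set (map label ts) \<or> set (map label ts') = insert m (set (map label ts))"
proof (induction m ts arbitrary: ts' rule: grafts.induct)
  case (2 m v cs ts)
  from "2.prems" consider "ts' = Node m [] # Node v cs # ts"
    | cs' where "ts' = Node v cs' # ts"
    | us where "ts' = Node v cs # us" "us \<in> set (grafts m ts)"
    by auto
  then show ?case
  proof cases
    case (3 us)
    then show ?thesis using "2.IH"(2)[OF 3(2)]
      by (elim disjE) (simp_all only: list.map list.set otree.sel insert_commute simp_thms)
  qed auto
qed simp

lemma grafts_nonempty: "ts' \<in> set (grafts m ts) \<Longrightarrow> ts' \<noteq> []"
  by (cases "(m, ts)" rule: grafts.cases) auto

lemma Cons_in_grafts: "Node m [] # ts \<in> set (grafts m ts)"
  by (cases "(m, ts)" rule: grafts.cases) simp_all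

lemma increasing_Cons:
  "increasing (Node k (Node v cs # ts)) \<longleftrightarrow>
     k < v \<and> increasing (Node v cs) \<and> increasing (Node k ts)"
  by auto

lemma grafts_increasing:
  "\<lbrakk>ts' \<in> set (grafts m ts); increasing (Node k ts); k < m; \<forall>x\<in>set (forest_labels ts). x < m\<rbrakk> \<Longrightarrow>
     increasing (Node k ts')"
proof (induction m ts arbitrary: ts' k rule: grafts.induct)
  case (1 m)
  then show ?case by simp
next
  case (2 m v cs ts)
  from "2.prems"(1) consider "ts' = Node m [] # Node v cs # ts"
    | cs' where "ts' = Node v cs' # ts" "cs' \<in> set (grafts m cs)"
    | us where "ts' = Node v cs # us" "us \<in> set (grafts m ts)"
    by auto
  then show ?case
  proof cases
    case 1
    then show ?thesis using "2.prems"(2,3) by (simp only: increasing_Cons) simp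
  next
    case (2 cs')
    then have "increasing (Node v cs')" using "2.IH"(1)[OF 2(2), of v] "2.prems"(2-4)
      by (simp only: increasing_Cons) simp
    with 2(1) "2.prems"(2) show ?thesis by (simp only: increasing_Cons)
  next
    case (3 us)
    then have "increasing (Node k us)" using "2.IH"(2)[OF 3(2), of k] "2.prems"(2-4)
      by (simp only: increasing_Cons) simp
    with 3(1) "2.prems"(2) show ?thesis by (simp only: increasing_Cons)
  qed
qed

lemma prune_fresh: "m \<notin> set (forest_labels ts) \<Longrightarrow> prune m ts = ts"
  by (induction m ts rule: prune.induct) auto

lemma prune_grafts:
  "\<lbrakk>ts' \<in> set (grafts m ts); m \<notin> set (forest_labels ts)\<rbrakk> \<Longrightarrow> prune m ts' = ts"
  by (induction m ts arbitrary: ts' rule: grafts.induct) (auto simp: prune_fresh)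

lemma distinct_grafts: "m \<notin> set (forest_labels ts) \<Longrightarrow> distinct (grafts m ts)"
proof (induction m ts rule: grafts.induct)
  case (2 m v cs ts)
  have "cs \<notin> set (grafts m cs)"
    using grafts_labels[of cs m cs] by auto
  with 2 show ?case by (auto simp: distinct_map inj_on_def)
qed simp

lemma label_le: "\<lbrakk>increasing t; x \<in> set (labels t)\<rbrakk> \<Longrightarrow> label t \<le> x"
proof (induction t rule: labels.induct)
  case (1 k ts)
  then show ?case by (fastforce dest: less_imp_le intro: order_trans)
qed

text \<open>In an increasing forest with distinct labels the largest label \<open>m\<close> is at a leaf. Hence the
  forest arises by grafting \<open>m\<close>, and by \<open>prune_grafts\<close> from only one smaller forest.\<close>

lemma grafts_prune: "increasing (Node k ts) \<Longrightarrow> distinct (forest_labels ts) \<Longrightarrow>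
  \<forall>x\<in>set (forest_labels ts). x \<le> m \<Longrightarrow> m \<in> set (forest_labels ts) \<Longrightarrow>
  ts \<in> set (grafts m (prune m ts)) \<and> increasing (Node k (prune m ts))"
proof (induction m ts arbitrary: k rule: prune.induct)
  case (2 m v cs ts)
  note inc = increasing_Cons
  have k: "k < v" "increasing (Node v cs)" "increasing (Node k ts)"
    using "2.prems"(1) by auto
  have le: "\<forall>x\<in>set (forest_labels cs). v < x"
    using k(2) label_le by fastforce
  consider "v = m" | "v \<noteq> m" "m \<in> set (forest_labels cs)" "m \<notin> set (forest_labels ts)"
    | "v \<noteq> m" "m \<notin> set (forest_labels cs)" "m \<in> set (forest_labels ts)"
    using "2.prems"(2,4) by (auto simp del: set_concat)
  then show ?case
  proof cases
    case 1
    have "m \<notin> set (forest_labels ts)" using 1 "2.prems"(2) by auto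
    then have p: "prune m ts = ts" by (rule prune_fresh)
    have "forest_labels cs = []"
    proof (rule ccontr)
      assume "forest_labels cs \<noteq> []"
      then obtain x where "x \<in> set (forest_labels cs)" by (meson last_in_set)
      with le 1 "2.prems"(3) show False by (force simp: not_less[symmetric])
    qed
    then have "cs = []" by (simp only: forest_labels_empty_iff)
    with p 1 k(3) Cons_in_grafts[of m ts] show ?thesis by simp
  next
    case 2
    then have "cs \<in> set (grafts m (prune m cs)) \<and> increasing (Node v (prune m cs))"
      using "2.IH"(2)[OF 2(1) k(2)] "2.prems"(2,3) 2(2) by simp
    with 2 k show ?thesis
      by (simp only: inc grafts.simps prune.simps if_False) (simp add: prune_fresh)
  next
    case 3
    then have "ts \<in> set (grafts m (prune m ts)) \<and> increasing (Node k (prune m ts))"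
      using "2.IH"(3)[OF 3(1) k(3)] "2.prems"(2,3) 3(3) by simp
    with 3 k show ?thesis
      by (simp only: inc grafts.simps prune.simps if_False) (simp add: prune_fresh)
  qed
qed simp


section \<open>How grafting changes the weight\<close>

text \<open>A new left sibling with a label above all others may enter a big cohort, but it cannot
  become the smallest entry unless the cohort was empty. The following lemmas draw the consequences
  for associates, and then for weights.\<close>

lemma set_takeWhile_insert:
  assumes "P m"
  shows "set (takeWhile P (xs @ m # ys)) = set (takeWhile P (xs @ ys)) \<or>
         set (takeWhile P (xs @ m # ys)) = insert m (set (takeWhile P (xs @ ys)))"
  using assms by (induction xs) auto

lemma big_cohort_bounded:
  assumes "ends_descent v ls" "\<forall>u\<in>set ls. u < m"
  shows "big_cohort v ls \<noteq> []" "\<forall>u\<in>set (big_cohort v ls). u < m"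
  using assms
  by (cases ls rule: rev_cases; auto simp: ends_descent_def big_cohort_def dest!: set_takeWhileD)+

lemma associate_less:
  assumes "ends_descent v ls" "\<forall>u\<in>set ls. u < m"
  shows "associate v ls < m"
  using big_cohort_bounded[OF assms] by (simp add: associate_def)

lemma associate_insert_max:
  assumes "ends_descent v (ls1 @ ls2)" "\<forall>u\<in>set (ls1 @ ls2). u < m" "v < m"
  shows "associate v (ls1 @ m # ls2) = associate v (ls1 @ ls2)"
proof -
  let ?C = "set (big_cohort v (ls1 @ ls2))"
  have "Min ?C < m" "?C \<noteq> {}"
    using big_cohort_bounded[OF assms(1,2)] by simp_all
  then have "Min (insert m ?C) = Min ?C" by (subst Min_insert) auto
  moreover have "set (big_cohort v (ls1 @ m # ls2)) = ?C \<or>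
      set (big_cohort v (ls1 @ m # ls2)) = insert m ?C"
    using set_takeWhile_insert[of "\<lambda>u. u > v" m "rev ls2" "rev ls1"] assms(3)
    by (simp add: big_cohort_def)
  ultimately show ?thesis by (auto simp: associate_def)
qed

lemma not_ends_descent_max: "\<forall>u\<in>set ls. u < m \<Longrightarrow> \<not> ends_descent m ls"
  by (metis ends_descent_def last_in_set less_asym)

lemma context_weight_insert_max:
  assumes "ls2 \<noteq> []" "\<forall>u\<in>set (ls1 @ ls2). u < m" "v < m"
  shows "context_weight (ls1 @ m # ls2, v, cs) = context_weight (ls1 @ ls2, v, cs)"
proof -
  have "ends_descent v (ls1 @ m # ls2) \<longleftrightarrow> ends_descent v (ls1 @ ls2)"
    using assms(1) by (simp add: ends_descent_def)
  with associate_insert_max[OF _ assms(2,3)] show ?thesis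
    by (auto simp: context_weight_def)
qed

lemma forest_weight_insert_max:
  assumes "ls2 \<noteq> []" "\<forall>u\<in>set (ls1 @ ls2). u < m" "\<forall>u\<in>set (forest_labels ts). u < m"
  shows "forest_weight (ls1 @ m # ls2) ts = forest_weight (ls1 @ ls2) ts"
  using assms
proof (induction "ls1 @ ls2" ts arbitrary: ls2 rule: vertex_contexts.induct)
  case (2 v cs ts)
  have "forest_weight (ls1 @ m # (ls2 @ [v])) ts = forest_weight (ls1 @ (ls2 @ [v])) ts"
    using 2(2)[of "ls2 @ [v]"] 2(3-) by (simp add: ball_Un)
  with 2(3-) context_weight_insert_max[of ls2 ls1 m v] show ?case by simp
qed simp

text \<open>When \<open>m\<close> is put directly to the left of \<open>v\<close>, the vertex \<open>v\<close> ends a descent. If it did so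
  before, its associate is unchanged. Otherwise its associate is now \<open>m\<close>, which no child exceeds,
  and so \<open>v\<close> turns into a violator exactly if it is a leaf.\<close>

lemma context_weight_after_max:
  assumes "\<forall>u\<in>set ls. u < m" "v < m" "\<forall>c\<in>set cs. c < m"
  shows "context_weight (ls @ [m], v, cs) =
    (if leaf_context (ls, v, cs) then var_y else context_weight (ls, v, cs))"
proof -
  have desc: "ends_descent v (ls @ [m])" using assms(2) by (simp add: ends_descent_def)
  show ?thesis
  proof (cases "ends_descent v ls")
    case True
    then have "associate v (ls @ [m]) = associate v ls"
      using associate_insert_max[of v ls "[]" m] assms by simp
    with True desc show ?thesis by (auto simp: context_weight_def)
  next
    case False
    then have "takeWhile (\<lambda>u. v < u) (rev ls) = []"
      by (cases ls rule: rev_cases) (auto simp: ends_descent_def)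
    then have "associate v (ls @ [m]) = m"
      using assms(2) by (simp add: associate_def big_cohort_def)
    with False desc assms(3) show ?thesis
      by (cases cs) (auto simp: context_weight_def dest: less_asym)
  qed
qed

text \<open>A new child \<open>m\<close> of \<open>v\<close> exceeds the associate of \<open>v\<close>, so it does not affect whether \<open>v\<close> is a
  violator; all it can do is to make \<open>v\<close> cease to be a leaf.\<close>

lemma context_weight_graft_below:
  assumes "cs' \<in> set (grafts m cs)" "\<forall>u\<in>set ls. u < m"
  shows "context_weight (ls, v, map label cs') =
    (if leaf_context (ls, v, map label cs) then 1 else context_weight (ls, v, map label cs))"
proof -
  have "violator_context (ls, v, map label cs') \<longleftrightarrow> violator_context (ls, v, map label cs)"
    using grafts_top_labels[OF assms(1)] associate_less[OF _ assms(2), of v]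
    by (auto simp del: set_map)
  then show ?thesis
    using grafts_nonempty[OF assms(1)] by (auto simp: context_weight_def)
qed

lemma context_weight_cases:
  "leaf_context c \<Longrightarrow> context_weight c = var_z"
  "\<not> leaf_context c \<Longrightarrow> pderiv (context_weight c) = 0"
  by (cases c; auto simp: context_weight_def var_y_def pderiv_pCons)+

lemma pderiv_var [simp]: "pderiv var_y = 0" "pderiv var_z = 1"
  by (simp_all add: var_y_def var_z_def pderiv_pCons one_pCons)

text \<open>The coefficient of \<open>x\<close> in the exponential of the generating function. Combinatorially,
  \<open>1 + y\<close> is the contribution of the places below and directly to the left of a leaf of weight \<open>z\<close>,
  and \<open>2 z\<close> is what two other places contribute.\<close>

definition growth_rate :: "rat poly poly" where "growth_rate = 1 + var_y - 2 * var_z"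

text \<open>A forest with \<open>k\<close> vertices offers \<open>2 k + 1\<close> places for \<open>m\<close>. The new leaf itself always
  contributes \<open>z\<close>. For each vertex \<open>v\<close> that is a leaf of weight \<open>z\<close>, placing \<open>m\<close> below \<open>v\<close> replaces
  this \<open>z\<close> by \<open>1\<close>, and placing it directly to the left of \<open>v\<close> replaces it by \<open>y\<close>; no other weight
  ever changes. If there are \<open>j\<close> such leaves, the weight is therefore multiplied by
  \<open>j (1 + y) + (2 k + 1 - 2 j) z\<close> in total, and the factor \<open>j\<close> is produced by \<open>z\<close> times the
  derivative with respect to \<open>z\<close>.\<close>

lemma sum_forest_weight_grafts:
  assumes "\<forall>u\<in>set ls. u < m" "\<forall>u\<in>set (forest_labels ts). u < m"
  shows "(\<Sum>ts'\<leftarrow>grafts m ts. forest_weight ls ts') =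
    growth_rate * var_z * pderiv (forest_weight ls ts) +
    of_nat (2 * length (forest_labels ts) + 1) * var_z * forest_weight ls ts"
  using assms
proof (induction ls ts rule: vertex_contexts.induct)
  case (1 ls)
  then have "\<not> ends_descent m ls" by (simp add: not_ends_descent_max)
  then show ?case by (simp add: context_weight_def)
next
  case (2 ls v cs ts)
  let ?c = "(ls, v, map label cs)"
  define C where "C = forest_weight [] cs"
  define T where "T = forest_weight (ls @ [v]) ts"
  define a where "a = length (forest_labels cs)"
  define b where "b = length (forest_labels ts)"
  have lt: "v < m" "\<forall>u\<in>set (forest_labels cs). u < m" "\<forall>u\<in>set (forest_labels ts). u < m"
    using 2(4) by auto
  have top: "\<forall>c\<in>set (map label cs). c < m"
    using lt(2) label_in_labels by fastforce
  have IHcs: "(\<Sum>cs'\<leftarrow>grafts m cs. forest_weight [] cs') =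
      growth_rate * var_z * pderiv C + of_nat (2 * a + 1) * var_z * C"
    using "2.IH"(1) lt by (simp add: C_def a_def)
  have IHts: "(\<Sum>ts'\<leftarrow>grafts m ts. forest_weight (ls @ [v]) ts') =
      growth_rate * var_z * pderiv T + of_nat (2 * b + 1) * var_z * T"
    using "2.IH"(2) 2(3) lt by (simp add: T_def b_def)
  \<comment> \<open>The three kinds of places: before \<open>v\<close>, below \<open>v\<close>, and to the right of \<open>v\<close>.\<close>
  have "\<not> ends_descent m ls"
    using 2(3) by (rule not_ends_descent_max)
  then have "forest_weight ls (Node m [] # Node v cs # ts) =
      var_z * ((if leaf_context ?c then var_y else context_weight ?c) * C * T)"
    using forest_weight_insert_max[of "[v]" ls m ts] 2(3) lt
      context_weight_after_max[OF 2(3) lt(1) top]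
    by (simp add: context_weight_def C_def T_def)
  moreover have "(\<Sum>cs'\<leftarrow>grafts m cs. forest_weight ls (Node v cs' # ts)) =
      (\<Sum>cs'\<leftarrow>grafts m cs. (if leaf_context ?c then 1 else context_weight ?c) *
        forest_weight [] cs' * T)"
    by (rule arg_cong[where f = sum_list], rule map_cong[OF refl])
      (simp only: forest_weight_simps context_weight_graft_below[OF _ 2(3)] T_def)
  then have "(\<Sum>cs'\<leftarrow>grafts m cs. forest_weight ls (Node v cs' # ts)) =
      (if leaf_context ?c then 1 else context_weight ?c) *
        (growth_rate * var_z * pderiv C + of_nat (2 * a + 1) * var_z * C) * T"
    by (simp only: sum_list_const_mult sum_list_mult_const IHcs)
  moreover have "(\<Sum>us\<leftarrow>grafts m ts. forest_weight ls (Node v cs # us)) =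
      context_weight ?c * C * (growth_rate * var_z * pderiv T + of_nat (2 * b + 1) * var_z * T)"
    by (simp only: forest_weight_simps sum_list_const_mult IHts C_def)
  ultimately have total: "(\<Sum>ts'\<leftarrow>grafts m (Node v cs # ts). forest_weight ls ts') =
      var_z * ((if leaf_context ?c then var_y else context_weight ?c) * C * T) +
      (if leaf_context ?c then 1 else context_weight ?c) *
        (growth_rate * var_z * pderiv C + of_nat (2 * a + 1) * var_z * C) * T +
      context_weight ?c * C * (growth_rate * var_z * pderiv T + of_nat (2 * b + 1) * var_z * T)"
    by (simp add: o_def del: forest_weight_simps)
  have len: "length (forest_labels (Node v cs # ts)) = Suc (a + b)"
    by (simp add: a_def b_def)
  have weight: "forest_weight ls (Node v cs # ts) = context_weight ?c * C * T"
    by (simp add: C_def T_def)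
  show ?case
  proof (cases "leaf_context ?c")
    case True
    then have "C = 1" "a = 0" by (simp_all add: C_def a_def)
    with True show ?thesis
      unfolding total len weight
      by (simp add: context_weight_cases pderiv_mult growth_rate_def algebra_simps del: leaf_context.simps)
  next
    case False
    then show ?thesis
      unfolding total len weight
      by (simp add: context_weight_cases pderiv_mult algebra_simps del: leaf_context.simps)
  qed
qed


section \<open>The weight of a tree counts violators and leaves\<close>

lemma map_vertex_contexts: "map (\<lambda>(ls, v, cs). v) (vertex_contexts ls ts) = forest_labels ts"
  by (induction ls ts rule: vertex_contexts.induct) simp_all

lemma Cons_eq_append_Cons_iff:
  "(\<exists>pre s post. t # ts = pre @ s # post \<and> P pre s) \<longleftrightarrow>
     P [] t \<or> (\<exists>pre s post. ts = pre @ s # post \<and> P (t # pre) s)"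
  by (auto simp: Cons_eq_append_conv)

text \<open>The contexts of the roots of the forest \<open>ts\<close> if the siblings \<open>ls\<close> precede it: the part of
  \<open>vertex_contexts\<close> that does not descend into the trees.\<close>

definition child_context :: "otree list \<Rightarrow> nat list \<Rightarrow> nat list \<times> nat \<times> nat list \<Rightarrow> bool" where
  "child_context ts ls c \<longleftrightarrow> (\<exists>pre s post. ts = pre @ s # post \<and>
     c = (ls @ map label pre, label s, map label (children s)))"

lemma child_context_simps:
  "\<not> child_context [] ls c"
  "child_context (t # ts) ls c \<longleftrightarrow>
     c = (ls, label t, map label (children t)) \<or> child_context ts (ls @ [label t]) c"
  unfolding child_context_def by (simp, subst Cons_eq_append_Cons_iff, simp)

lemma vertex_contexts_iff:
  "c \<in> set (vertex_contexts ls ts) \<longleftrightarrow>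
     child_context ts ls c \<or> (\<exists>t\<in>set ts. \<exists>u\<in>subtrees t. child_context (children u) [] c)"
  by (induction ls ts rule: vertex_contexts.induct) (auto simp: child_context_simps)

lemma vertex_contexts_subtrees:
  "c \<in> set (vertex_contexts [] ts) \<longleftrightarrow>
     (\<exists>u\<in>subtrees (Node k ts). child_context (children u) [] c)"
  by (simp add: vertex_contexts_iff)

lemma left_siblings_iff:
  "left_siblings (Node k ts) v ls \<longleftrightarrow> (\<exists>cs. (ls, v, cs) \<in> set (vertex_contexts [] ts))"
  unfolding left_siblings_def vertex_contexts_subtrees[where k = k] child_context_def
  by (fastforce simp: map_eq_append_conv map_eq_Cons_conv)

lemma nonroot_subtree_iff:
  "(\<exists>l. (l, v, cs) \<in> set (vertex_contexts ls ts)) \<longleftrightarrow>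
     (\<exists>t\<in>set ts. \<exists>s\<in>subtrees t. label s = v \<and> map label (children s) = cs)"
  by (induction ls ts rule: vertex_contexts.induct) (simp_all add: ex_disj_distrib bex_Un, blast)

text \<open>Labels identify vertices only if they are distinct. Then the context found for \<open>v\<close> is the
  only one, and its last component lists all children of \<open>v\<close>.\<close>

lemma child_of_iff:
  assumes "distinct (labels (Node k ts))" "(ls, v, cs) \<in> set (vertex_contexts [] ts)"
  shows "child_of (Node k ts) v c \<longleftrightarrow> c \<in> set cs"
proof -
  let ?C = "vertex_contexts [] ts"
  have dist: "distinct (map (\<lambda>(ls, v, cs). v) ?C)"
    using assms(1) by (simp only: map_vertex_contexts) simp
  have "v \<in> set (forest_labels ts)"
    unfolding map_vertex_contexts[of "[]" ts, symmetric] using assms(2) by force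
  then have "v \<noteq> k" using assms(1) by auto
  have unique: "cs' = cs" if "(ls', v, cs') \<in> set ?C" for ls' cs'
  proof -
    have "inj_on (\<lambda>(ls, v, cs). v) (set ?C)" using dist by (simp add: distinct_map)
    from inj_onD[OF this _ that assms(2)] show ?thesis by simp
  qed
  have "child_of (Node k ts) v c \<longleftrightarrow>
      (\<exists>t\<in>set ts. \<exists>s\<in>subtrees t. label s = v \<and> c \<in> set (map label (children s)))"
    using \<open>v \<noteq> k\<close> by (auto simp: child_of_def)
  also have "\<dots> \<longleftrightarrow> (\<exists>cs' l. (l, v, cs') \<in> set ?C \<and> c \<in> set cs')"
  proof
    assume "\<exists>t\<in>set ts. \<exists>s\<in>subtrees t. label s = v \<and> c \<in> set (map label (children s))"
    then obtain t s where "t \<in> set ts" "s \<in> subtrees t" "label s = v" "c \<in> set (map label (children s))"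
      by blast
    then show "\<exists>cs' l. (l, v, cs') \<in> set ?C \<and> c \<in> set cs'"
      using nonroot_subtree_iff[of v "map label (children s)" "[]" ts] by blast
  next
    assume "\<exists>cs' l. (l, v, cs') \<in> set ?C \<and> c \<in> set cs'"
    then obtain cs' where "\<exists>l. (l, v, cs') \<in> set ?C" "c \<in> set cs'" by blast
    then show "\<exists>t\<in>set ts. \<exists>s\<in>subtrees t. label s = v \<and> c \<in> set (map label (children s))"
      unfolding nonroot_subtree_iff by blast
  qed
  also have "\<dots> \<longleftrightarrow> c \<in> set cs" using unique assms(2) by blast
  finally show ?thesis .
qed

lemma card_context_vertices:
  assumes "distinct (forest_labels ts)"
  shows "card {v. \<exists>ls cs. (ls, v, cs) \<in> set (vertex_contexts [] ts) \<and> P (ls, v, cs)} =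
    length (filter P (vertex_contexts [] ts))"
proof -
  let ?C = "vertex_contexts [] ts"
  have "distinct (map (\<lambda>(ls, v, cs). v) ?C)"
    using assms by (simp only: map_vertex_contexts)
  then have "distinct (map (\<lambda>(ls, v, cs). v) (filter P ?C))"
    by (rule distinct_map_filter)
  moreover have "{v. \<exists>ls cs. (ls, v, cs) \<in> set ?C \<and> P (ls, v, cs)} =
      set (map (\<lambda>(ls, v, cs). v) (filter P ?C))"
    by force
  ultimately show ?thesis using distinct_card by fastforce
qed

lemma forest_weight_eq:
  "forest_weight ls ts =
     var_y ^ length (filter violator_context (vertex_contexts ls ts)) *
     var_z ^ length (filter leaf_context (vertex_contexts ls ts))"
proof -
  have "prod_list (map context_weight cs) =
      var_y ^ length (filter violator_context cs) * var_z ^ length (filter leaf_context cs)" for cs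
    by (induction cs) (simp_all add: context_weight_def)
  then show ?thesis by (simp add: forest_weight_def)
qed

definition violators :: "otree \<Rightarrow> nat" where
  "violators t = card {v. klazar_violator t v}"

definition free_leaves :: "otree \<Rightarrow> nat" where
  "free_leaves t = card {v. leaf t v \<and> \<not> descent_terminator t v}"

lemma tree_weight:
  assumes "distinct (labels (Node k ts))"
  shows "var_y ^ violators (Node k ts) * var_z ^ free_leaves (Node k ts) = forest_weight [] ts"
proof -
  let ?C = "vertex_contexts [] ts" and ?t = "Node k ts"
  note child = child_of_iff[OF assms]
  have dist: "distinct (forest_labels ts)" using assms by simp
  have "klazar_violator ?t v \<longleftrightarrow> (\<exists>ls cs. (ls, v, cs) \<in> set ?C \<and> violator_context (ls, v, cs))" for v
    using child unfolding klazar_violator_def left_siblings_iff by fastforce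
  then have "{v. klazar_violator ?t v} =
      {v. \<exists>ls cs. (ls, v, cs) \<in> set ?C \<and> violator_context (ls, v, cs)}"
    by (intro Collect_cong)
  then have "violators ?t = length (filter violator_context ?C)"
    unfolding violators_def by (simp only: card_context_vertices[OF dist])
  moreover have "leaf ?t v \<and> \<not> descent_terminator ?t v \<longleftrightarrow>
      (\<exists>ls cs. (ls, v, cs) \<in> set ?C \<and> leaf_context (ls, v, cs))" for v
  proof -
    have nonroot: "v \<in> set (labels ?t) \<and> v \<noteq> k \<longleftrightarrow> (\<exists>ls cs. (ls, v, cs) \<in> set ?C)"
    proof -
      have "v \<in> set (labels ?t) \<and> v \<noteq> k \<longleftrightarrow> v \<in> set (forest_labels ts)"
        using assms by auto
      then show ?thesis unfolding map_vertex_contexts[of "[]" ts, symmetric] by force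
    qed
    have unique: "ls' = ls" if "(ls, v, cs) \<in> set ?C" "(ls', v, cs') \<in> set ?C" for ls cs ls' cs'
    proof -
      have "inj_on (\<lambda>(ls, v, cs). v) (set ?C)"
        using dist map_vertex_contexts[of "[]" ts] by (metis distinct_map)
      from inj_onD[OF this _ that] show ?thesis by simp
    qed
    have empty: "(\<nexists>c. child_of ?t v c) \<longleftrightarrow> cs = []" if "(ls, v, cs) \<in> set ?C" for ls cs
      using child[OF that] by (cases cs) auto
    show ?thesis
    proof
      assume leaf: "leaf ?t v \<and> \<not> descent_terminator ?t v"
      then obtain ls cs where C: "(ls, v, cs) \<in> set ?C"
        using nonroot by (auto simp only: leaf_def otree.sel)
      moreover have "cs = []" using leaf empty[OF C] by (simp only: leaf_def)
      moreover have "\<not> ends_descent v ls"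
        using leaf C unfolding descent_terminator_def left_siblings_iff by blast
      ultimately have "(ls, v, cs) \<in> set ?C \<and> leaf_context (ls, v, cs)" by simp
      then show "\<exists>ls cs. (ls, v, cs) \<in> set ?C \<and> leaf_context (ls, v, cs)" by blast
    next
      assume "\<exists>ls cs. (ls, v, cs) \<in> set ?C \<and> leaf_context (ls, v, cs)"
      then obtain ls cs where C: "(ls, v, cs) \<in> set ?C" "cs = []" "\<not> ends_descent v ls" by auto
      have "leaf ?t v"
        using nonroot C(1,2) empty[OF C(1)] unfolding leaf_def otree.sel by blast
      moreover have "\<not> descent_terminator ?t v"
        using unique[OF C(1)] C(3) unfolding descent_terminator_def left_siblings_iff by blast
      ultimately show "leaf ?t v \<and> \<not> descent_terminator ?t v" by blast
    qed
  qed
  then have "{v. leaf ?t v \<and> \<not> descent_terminator ?t v} =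
      {v. \<exists>ls cs. (ls, v, cs) \<in> set ?C \<and> leaf_context (ls, v, cs)}"
    by (intro Collect_cong)
  then have "free_leaves ?t = length (filter leaf_context ?C)"
    unfolding free_leaves_def by (simp only: card_context_vertices[OF dist])
  ultimately show ?thesis by (simp add: forest_weight_eq)
qed


section \<open>The recurrence for the weighted number of trees\<close>

definition increasing_forests :: "nat \<Rightarrow> otree list set" where
  "increasing_forests n = {ts. Node 0 ts \<in> increasing_trees n}"

text \<open>The root of an increasing tree carries the least label, here \<open>0\<close>, so only the forest below it
  matters.\<close>

lemma increasing_trees_eq: "increasing_trees n = Node 0 ` increasing_forests n"
proof -
  have "t \<in> Node 0 ` increasing_forests n" if t: "t \<in> increasing_trees n" for t
  proof -
    have "label t = 0"
      using t label_le[of t 0] by (simp add: increasing_trees_def)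
    with t show ?thesis
      by (cases t) (auto simp: increasing_forests_def)
  qed
  then show ?thesis by (auto simp: increasing_forests_def)
qed

lemma increasing_forests_iff:
  "ts \<in> increasing_forests n \<longleftrightarrow>
     increasing (Node 0 ts) \<and> distinct (forest_labels ts) \<and> set (forest_labels ts) = {1..n}"
proof -
  have "0 \<notin> set (forest_labels ts)" if "increasing (Node 0 ts)"
    using that label_le by fastforce
  moreover have "insert 0 A = {0..n} \<longleftrightarrow> A = {1..n}" if "0 \<notin> A" for A
  proof -
    have "{0..n} = insert 0 {1..n}" by auto
    with that show ?thesis by (simp add: insert_ident)
  qed
  ultimately show ?thesis
    by (auto simp: increasing_forests_def increasing_trees_def simp del: set_concat increasing.simps)
qed

lemma increasing_forests_0: "increasing_forests 0 = {[]}"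
proof -
  have "ts = []" if "set (forest_labels ts) = {}" for ts
    using that by (simp only: set_empty forest_labels_empty_iff)
  then show ?thesis by (auto simp: increasing_forests_iff simp del: set_concat)
qed

lemma length_increasing_forest:
  "ts \<in> increasing_forests n \<Longrightarrow> length (forest_labels ts) = n"
  using distinct_card[of "forest_labels ts"] by (simp add: increasing_forests_iff)

lemma increasing_forests_Suc:
  "increasing_forests (Suc n) = (\<Union>ts\<in>increasing_forests n. set (grafts (Suc n) ts))"
proof (intro equalityI subsetI)
  fix ts assume "ts \<in> increasing_forests (Suc n)"
  then have ts: "increasing (Node 0 ts)" "distinct (forest_labels ts)"
      "set (forest_labels ts) = {1..Suc n}"
    by (simp_all only: increasing_forests_iff)
  define us where "us = prune (Suc n) ts"
  have us: "ts \<in> set (grafts (Suc n) us)" "increasing (Node 0 us)"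
    unfolding us_def using grafts_prune[OF ts(1,2), of "Suc n"] unfolding ts(3) by simp_all
  have m: "mset (forest_labels ts) = add_mset (Suc n) (mset (forest_labels us))"
    using us(1) by (rule grafts_labels)
  then have "distinct (Suc n # forest_labels us)"
    using ts(2) by (metis mset.simps(2) mset_eq_imp_distinct_iff)
  moreover have "insert (Suc n) (set (forest_labels us)) = {1..Suc n}"
    using m ts(3) by (metis set_mset_add_mset_insert set_mset_mset)
  ultimately have "distinct (forest_labels us)" "set (forest_labels us) = {1..Suc n} - {Suc n}"
    by auto
  moreover have "{1..Suc n} - {Suc n} = {1..n}" by auto
  ultimately have "us \<in> increasing_forests n"
    using us(2) by (simp only: increasing_forests_iff)
  with us(1) show "ts \<in> (\<Union>ts\<in>increasing_forests n. set (grafts (Suc n) ts))" by blast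
next
  fix ts assume "ts \<in> (\<Union>ts\<in>increasing_forests n. set (grafts (Suc n) ts))"
  then obtain us where us: "us \<in> increasing_forests n" "ts \<in> set (grafts (Suc n) us)" by blast
  then have inc: "increasing (Node 0 us)" "distinct (forest_labels us)"
      "set (forest_labels us) = {1..n}"
    by (simp_all only: increasing_forests_iff)
  have m: "mset (forest_labels ts) = mset (Suc n # forest_labels us)"
    using grafts_labels[OF us(2)] by simp
  then have "distinct (forest_labels ts)"
    using inc mset_eq_imp_distinct_iff[OF m] by (simp del: set_concat)
  moreover have "set (forest_labels ts) = {1..Suc n}"
    using inc(3) mset_eq_setD[OF m] by (simp del: set_concat) auto
  moreover have "increasing (Node 0 ts)"
    using grafts_increasing[OF us(2) inc(1)] inc(3) by (simp del: set_concat increasing.simps)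
  ultimately show "ts \<in> increasing_forests (Suc n)" by (simp only: increasing_forests_iff)
qed

definition weight_sum :: "nat \<Rightarrow> rat poly poly" where
  "weight_sum n = (\<Sum>ts\<in>increasing_forests n. forest_weight [] ts)"

lemma finite_increasing_forests: "finite (increasing_forests n)"
  using finite_increasing_trees[of n] by (simp add: increasing_trees_eq finite_image_iff inj_on_def)

lemma pderiv_sum: "pderiv (\<Sum>i\<in>A. f i) = (\<Sum>i\<in>A. pderiv (f i))"
  by (induction A rule: infinite_finite_induct) (simp_all add: pderiv_add)

lemma weight_sum_Suc:
  "weight_sum (Suc n) =
     growth_rate * var_z * pderiv (weight_sum n) + of_nat (2 * n + 1) * var_z * weight_sum n"
proof -
  have fresh: "Suc n \<notin> set (forest_labels ts)" "\<forall>u\<in>set (forest_labels ts). u < Suc n"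
    if "ts \<in> increasing_forests n" for ts
    using that by (auto simp: increasing_forests_iff simp del: set_concat)
  have "weight_sum (Suc n) =
      (\<Sum>ts\<in>increasing_forests n. \<Sum>ts'\<in>set (grafts (Suc n) ts). forest_weight [] ts')"
    unfolding weight_sum_def increasing_forests_Suc
  proof (rule sum.UNION_disjoint)
    show "\<forall>i\<in>increasing_forests n. \<forall>j\<in>increasing_forests n. i \<noteq> j \<longrightarrow>
        set (grafts (Suc n) i) \<inter> set (grafts (Suc n) j) = {}"
      using prune_grafts fresh(1) by (metis disjoint_iff)
  qed (simp_all add: finite_increasing_forests)
  also have "\<dots> = (\<Sum>ts\<in>increasing_forests n. \<Sum>ts'\<leftarrow>grafts (Suc n) ts. forest_weight [] ts')"
    using fresh(1) by (intro sum.cong refl)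
      (simp add: sum_list_distinct_conv_sum_set distinct_grafts del: set_concat)
  also have "\<dots> = (\<Sum>ts\<in>increasing_forests n. growth_rate * var_z * pderiv (forest_weight [] ts) +
      of_nat (2 * n + 1) * var_z * forest_weight [] ts)"
  proof (rule sum.cong[OF refl])
    fix ts assume "ts \<in> increasing_forests n"
    from sum_forest_weight_grafts[OF _ fresh(2)[OF this], of "[]"] length_increasing_forest[OF this]
    show "(\<Sum>ts'\<leftarrow>grafts (Suc n) ts. forest_weight [] ts') =
        growth_rate * var_z * pderiv (forest_weight [] ts) +
        of_nat (2 * n + 1) * var_z * forest_weight [] ts"
      by simp
  qed
  also have "\<dots> = growth_rate * var_z * pderiv (weight_sum n) +
      of_nat (2 * n + 1) * var_z * weight_sum n"
    by (simp only: weight_sum_def sum.distrib sum_distrib_left[symmetric] pderiv_sum)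
  finally show ?thesis .
qed

lemma weight_sum_0: "weight_sum 0 = 1"
  by (simp add: weight_sum_def increasing_forests_0)

lemma smult_sum_right: "smult c (\<Sum>i\<in>A. f i) = (\<Sum>i\<in>A. smult c (f i))"
  by (induction A rule: infinite_finite_induct) (simp_all add: smult_add_right)

text \<open>Sorting the trees by the values of the two statistics turns the weighted sum into the counts
  \<open>tree_count\<close>.\<close>

lemma tree_gf_nth: "tree_gf $ n = smult [:1 / fact n:] (weight_sum n)"
proof -
  let ?w = "\<lambda>i j. var_y ^ i * var_z ^ j"
  let ?T = "\<lambda>i j. {t \<in> increasing_trees n. violators t = i \<and> free_leaves t = j}"
  have count: "tree_count n i j = card (?T i j)" for i j
    by (simp add: tree_count_def violators_def free_leaves_def)
  have bound: "violators t \<le> n \<and> free_leaves t \<le> n" if "t \<in> increasing_trees n" for t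
  proof (rule ccontr)
    assume "\<not> ?thesis"
    then have "card (?T (violators t) (free_leaves t)) = 0"
      using tree_count_eq_0 count by (metis not_less)
    moreover have "finite (?T (violators t) (free_leaves t))" using finite_increasing_trees by simp
    ultimately have "?T (violators t) (free_leaves t) = {}" by (simp only: card_0_eq)
    with that show False by blast
  qed
  have "weight_sum n = (\<Sum>t\<in>increasing_trees n. ?w (violators t) (free_leaves t))"
    unfolding weight_sum_def increasing_trees_eq
    by (subst sum.reindex)
      (auto simp: inj_on_def increasing_forests_def increasing_trees_def
        simp del: labels.simps intro!: sum.cong tree_weight[symmetric])
  also have "\<dots> = (\<Sum>p\<in>{..n} \<times> {..n}. \<Sum>t\<in>{t \<in> increasing_trees n. (violators t, free_leaves t) = p}.
      ?w (violators t) (free_leaves t))"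
    using bound by (intro sum.group[symmetric]) (auto simp: finite_increasing_trees)
  also have "\<dots> = (\<Sum>p\<in>{..n} \<times> {..n}. of_nat (tree_count n (fst p) (snd p)) * ?w (fst p) (snd p))"
    by (intro sum.cong refl) (auto simp: count prod_eq_iff)
  also have "\<dots> = (\<Sum>i\<le>n. \<Sum>j\<le>n. of_nat (tree_count n i j) * ?w i j)"
    by (simp add: sum.cartesian_product case_prod_beta)
  finally have "weight_sum n = (\<Sum>i\<le>n. \<Sum>j\<le>n. of_nat (tree_count n i j) * ?w i j)" .
  moreover have "smult [:of_nat k / fact n:] p = smult [:1 / fact n:] (of_nat k * p)"
    for k and p :: "rat poly poly"
    by (simp add: of_nat_poly)
  ultimately show ?thesis
    by (simp add: tree_gf_def smult_sum_right)
qed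


section \<open>The partial differential equation\<close>

definition fps_deriv_z :: "rat poly poly fps \<Rightarrow> rat poly poly fps" where
  "fps_deriv_z f = Abs_fps (\<lambda>n. pderiv (f $ n))"

lemma fps_deriv_z_nth [simp]: "fps_deriv_z f $ n = pderiv (f $ n)"
  by (simp add: fps_deriv_z_def)

lemma fps_deriv_z_mult: "fps_deriv_z (f * g) = f * fps_deriv_z g + fps_deriv_z f * g"
  by (rule fps_ext)
    (simp add: fps_mult_nth pderiv_sum pderiv_mult sum.distrib mult.commute[of "pderiv _"])

text \<open>In terms of \<open>x\<close>, \<open>y\<close>, \<open>z\<close> and \<open>a = 1 + y - 2 z\<close>, the equation is
  \<open>(1 - 2 x z) f\<^sub>x = a z f\<^sub>z + c f\<close>. It says that the derivation
  \<open>(1 - 2 x z) \<partial>\<^sub>x - a z \<partial>\<^sub>z\<close> multiplies \<open>f\<close> by \<open>c\<close>, so the factors \<open>c\<close> add up when solutions are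
  multiplied.\<close>

definition solves_pde :: "rat poly poly \<Rightarrow> rat poly poly fps \<Rightarrow> bool" where
  "solves_pde c f \<longleftrightarrow> (1 - fps_const (2 * var_z) * fps_X) * fps_deriv f =
     fps_const (growth_rate * var_z) * fps_deriv_z f + fps_const c * f"

lemma solves_pde_mult:
  assumes "solves_pde c f" "solves_pde d g"
  shows "solves_pde (c + d) (f * g)"
proof -
  let ?u = "1 - fps_const (2 * var_z) * fps_X" and ?v = "fps_const (growth_rate * var_z)"
  have "?u * fps_deriv (f * g) = f * (?u * fps_deriv g) + (?u * fps_deriv f) * g"
    by (simp only: fps_deriv_mult distrib_left distrib_right mult.assoc mult.commute mult.left_commute)
  also have "\<dots> = f * (?v * fps_deriv_z g + fps_const d * g) +
      (?v * fps_deriv_z f + fps_const c * f) * g"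
    using assms by (simp only: solves_pde_def)
  also have "\<dots> = ?v * fps_deriv_z (f * g) + fps_const (c + d) * (f * g)"
    by (simp only: fps_deriv_z_mult algebra_simps flip: fps_const_add)
  finally show ?thesis by (simp only: solves_pde_def)
qed

text \<open>Read off at \<open>x\<^sup>n\<close>, the equation determines each coefficient from the one before, and so
  a solution is determined by its constant term in \<open>x\<close>.\<close>

lemma solves_pde_iff:
  "solves_pde c f \<longleftrightarrow> (\<forall>n. of_nat (Suc n) * f $ Suc n =
     growth_rate * var_z * pderiv (f $ n) + (c + of_nat (2 * n) * var_z) * f $ n)"
proof -
  have "((1 - fps_const (2 * var_z) * fps_X) * fps_deriv f) $ n =
      of_nat (Suc n) * f $ Suc n - of_nat (2 * n) * var_z * f $ n" for n
    by (cases n) (simp_all add: left_diff_distrib mult.assoc)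
  then show ?thesis by (simp add: solves_pde_def fps_eq_iff algebra_simps)
qed

lemma solves_pde_unique:
  assumes "solves_pde c f" "solves_pde c g" "f $ 0 = g $ 0"
  shows "f = g"
proof (rule fps_ext)
  fix n
  show "f $ n = g $ n"
  proof (induction n)
    case (Suc n)
    then have "of_nat (Suc n) * f $ Suc n = of_nat (Suc n) * g $ Suc n"
      using assms(1,2) by (simp only: solves_pde_iff)
    then show ?case by (simp only: mult_cancel_left of_nat_eq_0_iff) simp
  qed (rule assms(3))
qed

lemma smult_one [simp]: "smult [:1:] p = (p :: rat poly poly)"
  by (simp flip: one_pCons)

lemma smult_inverse_fact:
  "of_nat (Suc n) * smult [:1 / fact (Suc n):] p = smult [:1 / fact n:] (p :: rat poly poly)"
proof -
  have "of_nat (Suc n) / fact (Suc n) = (1 / fact n :: rat)"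
    by (simp add: fact_Suc del: of_nat_Suc)
  then show ?thesis by (simp add: of_nat_poly del: of_nat_Suc fact_Suc)
qed

lemma solves_pde_tree_gf: "solves_pde var_z tree_gf"
  unfolding solves_pde_iff
proof
  fix n
  have "of_nat (Suc n) * tree_gf $ Suc n = smult [:1 / fact n:] (weight_sum (Suc n))"
    by (simp only: tree_gf_nth smult_inverse_fact)
  also have "\<dots> = growth_rate * var_z * pderiv (tree_gf $ n) +
      (var_z + of_nat (2 * n) * var_z) * tree_gf $ n"
    by (simp add: tree_gf_nth weight_sum_Suc pderiv_smult smult_add_right algebra_simps)
  finally show "of_nat (Suc n) * tree_gf $ Suc n = growth_rate * var_z * pderiv (tree_gf $ n) +
      (var_z + of_nat (2 * n) * var_z) * tree_gf $ n" .
qed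

text \<open>The series \<open>exp (x (1 + y - 2 z))\<close>. Its coefficients are polynomials, so that it can be
  differentiated with respect to \<open>z\<close> before passing to rational functions.\<close>

definition poly_exp :: "rat poly poly fps" where
  "poly_exp = Abs_fps (\<lambda>n. smult [:1 / fact n:] (growth_rate ^ n))"

lemma poly_exp_Suc: "of_nat (Suc n) * poly_exp $ Suc n = growth_rate * poly_exp $ n"
  unfolding poly_exp_def by (simp only: fps_nth_Abs_fps smult_inverse_fact) simp

lemma pderiv_growth_rate: "pderiv growth_rate = -2"
  by (simp add: growth_rate_def pderiv_add pderiv_diff pderiv_mult)

lemma solves_pde_denominator:
  "solves_pde 0 (fps_const (1 + var_y) - fps_const (2 * var_z) * poly_exp)"
  unfolding solves_pde_iff
proof
  fix n
  let ?D = "fps_const (1 + var_y) - fps_const (2 * var_z) * poly_exp"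
  have deriv: "pderiv (poly_exp $ Suc k) = - 2 * poly_exp $ k" for k
  proof -
    have "pderiv (poly_exp $ Suc k) = of_nat (Suc k) * smult [:1 / fact (Suc k):] (- 2 * growth_rate ^ k)"
      by (simp add: poly_exp_def pderiv_smult pderiv_power_Suc pderiv_growth_rate of_nat_poly
          mult.commute del: of_nat_Suc fact_Suc power_Suc)
    then show ?thesis by (simp only: smult_inverse_fact) (simp add: poly_exp_def)
  qed
  have "of_nat (Suc n) * ?D $ Suc n = - 2 * var_z * (of_nat (Suc n) * poly_exp $ Suc n)"
    by (simp add: mult.left_commute del: of_nat_Suc)
  also have "\<dots> = - 2 * var_z * growth_rate * poly_exp $ n"
    by (simp only: poly_exp_Suc mult.assoc)
  also have "\<dots> = growth_rate * var_z * pderiv (?D $ n) + (0 + of_nat (2 * n) * var_z) * ?D $ n"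
  proof (cases n)
    case 0
    then show ?thesis
      by (simp add: poly_exp_def pderiv_add pderiv_diff pderiv_mult)
  next
    case (Suc k)
    have "of_nat (2 * n) * var_z * ?D $ n = - 4 * var_z ^ 2 * (of_nat (Suc k) * poly_exp $ Suc k)"
      by (simp add: Suc power2_eq_square algebra_simps)
    also have "\<dots> = - 4 * var_z ^ 2 * (growth_rate * poly_exp $ k)"
      by (simp only: poly_exp_Suc)
    finally have "of_nat (2 * n) * var_z * ?D $ n = - 4 * var_z ^ 2 * (growth_rate * poly_exp $ k)" .
    moreover have "pderiv (?D $ n) = 4 * var_z * poly_exp $ k - 2 * poly_exp $ n"
      by (simp add: Suc deriv pderiv_minus pderiv_mult)
    ultimately show ?thesis by (simp only:) (simp add: power2_eq_square algebra_simps)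
  qed
  finally show "of_nat (Suc n) * ?D $ Suc n =
      growth_rate * var_z * pderiv (?D $ n) + (0 + of_nat (2 * n) * var_z) * ?D $ n" .
qed

text \<open>By the product rule the left-hand side solves the equation with \<open>c = z + z + 0\<close>. So does the
  constant \<open>1 + y - 2 z\<close>, and both have the same constant term.\<close>

lemma tree_gf_square:
  "tree_gf ^ 2 * (fps_const (1 + var_y) - fps_const (2 * var_z) * poly_exp) = fps_const growth_rate"
proof (rule solves_pde_unique)
  show "solves_pde (2 * var_z) (tree_gf ^ 2 * (fps_const (1 + var_y) - fps_const (2 * var_z) * poly_exp))"
    using solves_pde_mult[OF solves_pde_mult[OF solves_pde_tree_gf solves_pde_tree_gf] solves_pde_denominator]
    by (simp add: power2_eq_square)
  show "solves_pde (2 * var_z) (fps_const growth_rate)"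
    by (simp add: solves_pde_iff pderiv_growth_rate)
  show "(tree_gf ^ 2 * (fps_const (1 + var_y) - fps_const (2 * var_z) * poly_exp)) $ 0 =
      fps_const growth_rate $ 0"
    by (simp add: tree_gf_nth weight_sum_0 poly_exp_def growth_rate_def power2_eq_square)
qed


section \<open>Passing to rational functions\<close>

lemma embed_fps_nth [simp]: "embed_fps f $ n = to_fract (f $ n)"
  by (simp add: embed_fps_def)

lemma embed_fps_mult: "embed_fps (f * g) = embed_fps f * embed_fps g"
  by (rule fps_ext) (simp add: fps_mult_nth)

lemma embed_fps_diff: "embed_fps (f - g) = embed_fps f - embed_fps g"
  by (rule fps_ext) simp

lemma embed_fps_const: "embed_fps (fps_const c) = fps_const (to_fract c)"
  by (rule fps_ext) simp

lemma to_fract_of_nat: "to_fract (of_nat n) = of_nat n"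
  by (induction n) simp_all

lemma to_fract_growth_rate: "to_fract growth_rate = 1 + Y - 2 * Z"
proof -
  have "to_fract 2 = (2 :: ratfun)" using to_fract_of_nat[of 2] by simp
  then show ?thesis by (simp add: growth_rate_def Y_def Z_def)
qed

lemma embed_poly_exp: "embed_fps poly_exp = fps_exp (1 + Y - 2 * Z)"
proof (rule fps_ext)
  fix n
  have "of_nat (fact n) * poly_exp $ n = growth_rate ^ n"
    by (simp add: poly_exp_def of_nat_poly)
  then have "of_nat (fact n) * to_fract (poly_exp $ n) = to_fract (growth_rate ^ n)"
    by (metis to_fract_mult to_fract_of_nat)
  moreover have "to_fract (p ^ n) = to_fract p ^ n" for p :: "rat poly poly"
    by (induction n) simp_all
  ultimately show "embed_fps poly_exp $ n = fps_exp (1 + Y - 2 * Z) $ n"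
    by (simp add: field_simps to_fract_growth_rate)
qed

theorem theorem3:
  shows "embed_fps tree_gf =
    fps_sqrt (fps_const (1 + Y - 2 * Z) /
      (fps_const (1 + Y) - fps_const (2 * Z) * fps_exp (1 + Y - 2 * Z)))"
proof -
  let ?A = "fps_const (1 + Y - 2 * Z)"
  let ?D = "fps_const (1 + Y) - fps_const (2 * Z) * fps_exp (1 + Y - 2 * Z)"
  let ?S = "fps_sqrt (?A / ?D)"
  let ?F = "embed_fps tree_gf"
  have two: "to_fract 2 = (2 :: ratfun)" using to_fract_of_nat[of 2] by simp
  have "?F ^ 2 * ?D = ?A"
    using arg_cong[OF tree_gf_square, of embed_fps]
    by (simp add: power2_eq_square embed_fps_mult embed_fps_diff embed_fps_const embed_poly_exp
        to_fract_growth_rate Y_def Z_def two)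
  moreover have "?D \<noteq> 0"
    using rhs_nth_0 by (metis div_by_0 fps_zero_nth zero_neq_one)
  ultimately have "?F ^ 2 = ?A / ?D" by (metis nonzero_mult_div_cancel_right)
  then have "?F ^ 2 = ?S ^ 2" by (simp only: fps_sqrt_rhs(1))
  then consider "?F = ?S" | "?F = - ?S" by (auto simp: power2_eq_iff)
  then show ?thesis
  proof cases
    \<comment> \<open>The sign is decided by the constant terms, both of which are \<open>1\<close>.\<close>
    case 2
    have "?F $ 0 = 1" by (simp add: tree_gf_nth weight_sum_0 flip: one_pCons)
    moreover have "?F $ 0 = - 1" by (simp only: 2 fps_neg_nth fps_sqrt_rhs(2))
    ultimately have "(1 :: ratfun) = - 1" by simp
    then show ?thesis by simp
  qed
qed

end
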